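(* There exists an instance for which the optimum identity-truthful algorithm does not adhere to a pricing mechanism.
   Context: An instance consists of $n$ boxes, where box $k$ contains a nonnegative stochastic reward with known distribution $F_k$, independently across boxes; write $F=F_1\times\cdots\times F_n$. The boxes arrive according to an arrival order $\pi$ (a permutation of $\{1,\dots,n\}$): the box arriving at step $i$ is box $\pi^{-1}(i)$ (this index is its identity), and its reward $v_i$, drawn from $F_{\pi^{-1}(i)}$, is revealed at step $i$. Upon observing $v_i$, the decision-maker must immediately and irrevocably decide whether to accept it (and stop) or to discard it and continue; one reward may be selected. An identity-truthful algorithm knows $F$ but not $\pi$ from the outset, and its decision whether to accept the $i$-th arriving reward may depend only on $v_1,\dots,v_i$ and on the identities $\pi^{-1}(1),\dots,\pi^{-1}(i-1)$ of the previously arrived boxes; it may not depend on the identity $\pi^{-1}(i)$ of the current box, which is learned only after the decision. The optimum identity-truthful algorithm for an instance is the identity-truthful algorithm with the highest guarantee on the expected selected reward, where the arrival order is unknown to the algorithm. A (dynamic) pricing mechanism is a sequence of thresholds $\tau_1,\dots,\tau_n$, where $\tau_i$ can depend on the information available to the online algorithm (such as the identities of the previously arrived boxes), such that at step $i$ the reward $v_i$ is accepted if and only if $v_i\ge\tau_i$. An algorithm adheres to a pricing mechanism if its acceptance rule has this form. *)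

theory Defs
  imports "HOL-Probability.Probability"
begin

text \<open>
  Boxes and steps are numbered \<open>1, \<dots>, n\<close>. The reward of box \<open>k\<close> has law \<open>F k\<close>; finite means are
  required so that expected rewards are genuine Bochner integrals.
\<close>

definition box_instance :: "nat \<Rightarrow> (nat \<Rightarrow> real measure) \<Rightarrow> bool" where
  "box_instance n F \<longleftrightarrow> n \<ge> 1 \<and>
     (\<forall>k\<in>{1..n}. prob_space (F k) \<and> sets (F k) = sets borel \<and>
        (AE x in F k. 0 \<le> x) \<and> integrable (F k) (\<lambda>x. x))"

definition joint_law :: "nat \<Rightarrow> (nat \<Rightarrow> real measure) \<Rightarrow> (nat \<Rightarrow> real) measure" where
  "joint_law n F = (\<Pi>\<^sub>M k\<in>{1..n}. F k)"

text \<open>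
  An arrival order \<open>\<pi>\<close> permutes \<open>{1..n}\<close> and maps boxes to steps, so box \<open>inv \<pi> i\<close> arrives at
  step \<open>i\<close>. A vector \<open>w\<close> gives the rewards indexed by boxes; the following are the rewards
  indexed by steps, and the observed histories.
\<close>

definition arriving_reward :: "(nat \<Rightarrow> nat) \<Rightarrow> (nat \<Rightarrow> real) \<Rightarrow> nat \<Rightarrow> real" where
  "arriving_reward \<pi> w i = w (inv \<pi> i)"

definition rewards_upto :: "(nat \<Rightarrow> nat) \<Rightarrow> (nat \<Rightarrow> real) \<Rightarrow> nat \<Rightarrow> real list" where
  "rewards_upto \<pi> w i = map (arriving_reward \<pi> w) [1..<Suc i]"

definition identities_upto :: "(nat \<Rightarrow> nat) \<Rightarrow> nat \<Rightarrow> nat list" where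
  "identities_upto \<pi> i = map (inv \<pi>) [1..<Suc i]"

text \<open>
  A decision rule \<open>A\<close> at step \<open>i\<close> receives the rewards of steps \<open>1, \<dots>, i\<close> and the identities of the
  boxes of steps \<open>1, \<dots>, i - 1\<close> only; the type thus hides the identity of the current box and
  the future order. What remains to be required of an identity-truthful algorithm is that its
  decisions are measurable in the observed rewards.
\<close>

type_synonym decision_rule = "real list \<Rightarrow> nat list \<Rightarrow> bool"

definition identity_truthful :: "nat \<Rightarrow> decision_rule \<Rightarrow> bool" where
  "identity_truthful n A \<longleftrightarrow>
     (\<forall>i\<in>{1..n}. \<forall>ids. (\<lambda>v. A (map v [1..<Suc i]) ids)
        \<in> measurable (\<Pi>\<^sub>M j\<in>{1..i}. (borel :: real measure)) (count_space UNIV))"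

definition accepts :: "decision_rule \<Rightarrow> (nat \<Rightarrow> nat) \<Rightarrow> (nat \<Rightarrow> real) \<Rightarrow> nat \<Rightarrow> bool" where
  "accepts A \<pi> w i \<longleftrightarrow> A (rewards_upto \<pi> w i) (identities_upto \<pi> (i - 1))"

definition selected_reward ::
    "nat \<Rightarrow> decision_rule \<Rightarrow> (nat \<Rightarrow> nat) \<Rightarrow> (nat \<Rightarrow> real) \<Rightarrow> real" where
  "selected_reward n A \<pi> w =
     (if \<exists>i\<in>{1..n}. accepts A \<pi> w i
      then arriving_reward \<pi> w (LEAST i. i \<in> {1..n} \<and> accepts A \<pi> w i)
      else 0)"

definition expected_reward ::
    "nat \<Rightarrow> (nat \<Rightarrow> real measure) \<Rightarrow> decision_rule \<Rightarrow> (nat \<Rightarrow> nat) \<Rightarrow> real" where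
  "expected_reward n F A \<pi> = (\<integral>w. selected_reward n A \<pi> w \<partial>joint_law n F)"

text \<open>The order is unknown, so an algorithm guarantees its worst expected reward over all orders.\<close>

definition guarantee :: "nat \<Rightarrow> (nat \<Rightarrow> real measure) \<Rightarrow> decision_rule \<Rightarrow> real" where
  "guarantee n F A = Min (expected_reward n F A ` {\<pi>. \<pi> permutes {1..n}})"

definition optimum_identity_truthful ::
    "nat \<Rightarrow> (nat \<Rightarrow> real measure) \<Rightarrow> decision_rule \<Rightarrow> bool" where
  "optimum_identity_truthful n F A \<longleftrightarrow> identity_truthful n A \<and>
     (\<forall>B. identity_truthful n B \<longrightarrow> guarantee n F B \<le> guarantee n F A)"

text \<open>
  The threshold of step \<open>i\<close> is a function of the rewards and identities of steps \<open>1, \<dots>, i - 1\<close>,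
  and in particular not of the current reward. Infinite thresholds are allowed, so that discarding
  every reward at some step counts as pricing.
\<close>

definition adheres_to_pricing :: "nat \<Rightarrow> decision_rule \<Rightarrow> bool" where
  "adheres_to_pricing n A \<longleftrightarrow>
     (\<exists>\<tau> :: real list \<Rightarrow> nat list \<Rightarrow> ereal.
        \<forall>\<pi> w. \<pi> permutes {1..n} \<longrightarrow> (\<forall>k\<in>{1..n}. 0 \<le> w k) \<longrightarrow>
          (\<forall>i\<in>{1..n}. accepts A \<pi> w i \<longleftrightarrow>
             ereal (arriving_reward \<pi> w i)
               \<ge> \<tau> (rewards_upto \<pi> w (i - 1)) (identities_upto \<pi> (i - 1))))"

end

theory Submission imports Defs begin

text \<open>
  Box 1 pays 0 or 3/2 and box 2 pays 1 or 3, each uniformly. The supports are disjoint, so the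
  first reward reveals which box arrived. The best guarantee is the mean 2 of box 2: if box 1 comes
  first, then rejecting 3/2 is necessary, since 3/2 is below that mean; if box 2 comes first, then
  accepting 1 is necessary, since 1 is above the mean 3/4 of box 1. So an optimum algorithm accepts
  1 but rejects 3/2 at step 1, which no threshold does.
\<close>

text \<open>Replaces the least accepting step by a case split, so that the later bounds turn only on
  how \<open>A\<close> answers a first reward.\<close>

lemma selected_reward_two:
  "selected_reward 2 A \<pi> w =
     (if A [w (inv \<pi> 1)] [] then w (inv \<pi> 1)
      else if A [w (inv \<pi> 1), w (inv \<pi> 2)] [inv \<pi> 1] then w (inv \<pi> 2) else 0)"
proof -
  have acc: "accepts A \<pi> w (Suc 0) = A [w (inv \<pi> 1)] []"
    "accepts A \<pi> w 2 = A [w (inv \<pi> 1), w (inv \<pi> 2)] [inv \<pi> 1]"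
    by (simp_all add: accepts_def rewards_upto_def identities_upto_def arriving_reward_def
        numeral_2_eq_2)
  have steps: "{1..2} = {Suc 0, 2}" by auto
  have first: "(LEAST i. (i = Suc 0 \<or> i = 2) \<and> accepts A \<pi> w i) = Suc 0" if "accepts A \<pi> w (Suc 0)"
    using that by (intro Least_equality) auto
  have second: "(LEAST i. (i = Suc 0 \<or> i = 2) \<and> accepts A \<pi> w i) = 2"
    if "\<not> accepts A \<pi> w (Suc 0)" "accepts A \<pi> w 2"
    using that by (intro Least_equality) auto
  show ?thesis
    unfolding selected_reward_def steps
    using first second by (auto simp: acc arriving_reward_def)
qed

lemma guarantee_le_expected_reward:
  assumes "\<pi> permutes {1..n}"
  shows "guarantee n F A \<le> expected_reward n F A \<pi>"
  unfolding guarantee_def using assms by (intro Min_le) (auto simp: finite_permutations)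

section \<open>Two independent uniform rewards, reduced to finite sums\<close>

definition uniform_law :: "real set \<Rightarrow> real measure" where
  "uniform_law S = distr (measure_pmf (pmf_of_set S)) borel (\<lambda>x. x)"

text \<open>Every index other than 1 gets the law on \<open>T\<close>, so the whole family consists
  of probability measures, as \<open>product_prob_space\<close> requires.\<close>

definition two_boxes :: "real set \<Rightarrow> real set \<Rightarrow> nat \<Rightarrow> real measure" where
  "two_boxes S T k = uniform_law (if k = 1 then S else T)"

text \<open>The push-forward along the identity trades the discrete sigma-algebra of the pmf for the
  Borel one that \<open>box_instance\<close> demands.\<close>

lemma sets_uniform_law [simp, measurable_cong]: "sets (uniform_law S) = sets borel"
  by (simp add: uniform_law_def)

lemma prob_space_uniform_law: "prob_space (uniform_law S)"
  unfolding uniform_law_def by (intro prob_space.prob_space_distr prob_space_measure_pmf) simp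

lemma emeasure_uniform_law:
  assumes "finite S" "S \<noteq> {}" "X \<in> sets borel"
  shows "emeasure (uniform_law S) X = ennreal (card (S \<inter> X) / card S)"
  using assms by (simp add: uniform_law_def emeasure_distr emeasure_pmf_of_set)

lemma box_instance_two_boxes:
  assumes "finite S" "S \<noteq> {}" "finite T" "T \<noteq> {}" "\<And>x. x \<in> S \<union> T \<Longrightarrow> 0 \<le> x"
  shows "box_instance 2 (two_boxes S T)"
proof -
  have "(AE x in uniform_law R. 0 \<le> x) \<and> integrable (uniform_law R) (\<lambda>x. x)"
    if "finite R" "R \<noteq> {}" "\<And>x. x \<in> R \<Longrightarrow> 0 \<le> x" for R
    using that unfolding uniform_law_def
    by (simp add: AE_distr_iff AE_measure_pmf_iff integrable_distr_eq integrable_measure_pmf_finite)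
  then show ?thesis
    using assms unfolding box_instance_def two_boxes_def by (auto simp: prob_space_uniform_law)
qed

text \<open>Restricting to \<open>{1..2}\<close> makes the vectors extensional, hence points of the
  product space.\<close>

definition reward_vector :: "real \<times> real \<Rightarrow> nat \<Rightarrow> real" where
  "reward_vector = (\<lambda>(x, y). \<lambda>k\<in>{1..2}. if k = 1 then x else y)"

lemma measurable_reward_vector:
  "reward_vector \<in> measure_pmf p \<rightarrow>\<^sub>M (\<Pi>\<^sub>M k\<in>{1..2}. borel)"
  by (auto simp: reward_vector_def space_PiM)

text \<open>A product measure is determined by its values on rectangles, and there the uniform law
  on \<open>S \<times> T\<close> factors, because cardinalities multiply.\<close>

lemma joint_law_two_boxes:
  assumes "finite S" "S \<noteq> {}" "finite T" "T \<noteq> {}"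
  shows "joint_law 2 (two_boxes S T) =
    distr (measure_pmf (pmf_of_set (S \<times> T))) (\<Pi>\<^sub>M k\<in>{1..2}. borel) reward_vector"
proof -
  interpret product_prob_space "two_boxes S T"
    by (intro product_prob_spaceI) (simp add: two_boxes_def prob_space_uniform_law)
  show ?thesis
    unfolding joint_law_def
  proof (rule PiM_eqI [symmetric])
    fix X :: "nat \<Rightarrow> real set"
    assume "\<And>k. k \<in> {1..2} \<Longrightarrow> X k \<in> sets (two_boxes S T k)"
    then have X: "X 1 \<in> sets borel" "X 2 \<in> sets borel" "\<And>k. k \<in> {1..2} \<Longrightarrow> X k \<in> sets borel"
      by (auto simp: two_boxes_def)
    have steps: "{1..2} = {Suc 0, 2}" by auto
    have vimage: "reward_vector -` Pi\<^sub>E {1..2} X = X 1 \<times> X 2"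
      unfolding steps by (auto simp: reward_vector_def PiE_iff split: if_splits)
    have "emeasure (distr (measure_pmf (pmf_of_set (S \<times> T))) (\<Pi>\<^sub>M k\<in>{1..2}. borel) reward_vector)
        (Pi\<^sub>E {1..2} X) = emeasure (measure_pmf (pmf_of_set (S \<times> T))) (X 1 \<times> X 2)"
      using X(3) by (subst emeasure_distr [OF measurable_reward_vector]) (auto simp: vimage simp del: One_nat_def intro!: sets_PiM_I_finite)
    also have "\<dots> = ennreal (card (S \<inter> X 1) / card S * (card (T \<inter> X 2) / card T))"
      using assms by (simp add: emeasure_pmf_of_set Times_Int_Times card_cartesian_product)
    also have "\<dots> = (\<Prod>k\<in>{1..2}. emeasure (two_boxes S T k) (X k))"
      using assms X(1,2) unfolding steps
      by (simp add: two_boxes_def emeasure_uniform_law flip: ennreal_mult)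
    finally show "emeasure (distr (measure_pmf (pmf_of_set (S \<times> T)))
        (\<Pi>\<^sub>M k\<in>{1..2}. borel) reward_vector) (Pi\<^sub>E {1..2} X) = \<dots>" .
  qed (auto simp: two_boxes_def intro!: sets_PiM_cong)
qed

lemma integral_two_boxes:
  fixes g :: "(nat \<Rightarrow> real) \<Rightarrow> real"
  assumes "finite S" "S \<noteq> {}" "finite T" "T \<noteq> {}"
    and g: "g \<in> borel_measurable (\<Pi>\<^sub>M k\<in>{1..2}. borel)"
  shows "integrable (joint_law 2 (two_boxes S T)) g"
    and "(\<integral>w. g w \<partial>joint_law 2 (two_boxes S T)) =
      (\<Sum>p\<in>S \<times> T. g (reward_vector p)) / (card S * card T)"
proof -
  show "integrable (joint_law 2 (two_boxes S T)) g"
    using assms unfolding joint_law_two_boxes [OF assms(1-4)]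
    by (subst integrable_distr_eq [OF measurable_reward_vector g])
      (simp add: integrable_measure_pmf_finite)
  show "(\<integral>w. g w \<partial>joint_law 2 (two_boxes S T)) =
      (\<Sum>p\<in>S \<times> T. g (reward_vector p)) / (card S * card T)"
    using assms unfolding joint_law_two_boxes [OF assms(1-4)]
    by (subst integral_distr [OF measurable_reward_vector g]) (simp add: integral_pmf_of_set card_cartesian_product)
qed

text \<open>The product space contains all real vectors over the two boxes; this confines pointwise
  estimates to the supports.\<close>

lemma AE_two_boxes:
  assumes "finite S" "S \<noteq> {}" "finite T" "T \<noteq> {}"
  shows "AE w in joint_law 2 (two_boxes S T). w 1 \<in> S \<and> w 2 \<in> T"
proof -
  have [measurable]: "S \<in> sets borel" "T \<in> sets borel"
    using assms by (auto intro: borel_closed finite_imp_closed)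
  have "{w \<in> space (\<Pi>\<^sub>M k\<in>{1..2::nat}. (borel :: real measure)). w 1 \<in> S \<and> w 2 \<in> T}
      \<in> sets (\<Pi>\<^sub>M k\<in>{1..2}. borel)"
    by measurable
  then show ?thesis
    using assms unfolding joint_law_two_boxes [OF assms]
    by (subst AE_distr_iff [OF measurable_reward_vector]) (auto simp: AE_measure_pmf_iff reward_vector_def)
qed

text \<open>The condition \<open>0 \<le> g w\<close> covers a selected reward that is not
  integrable, whose Bochner integral is 0 by convention. So the bound applies to an arbitrary rule
  \<open>A\<close>.\<close>

lemma expected_reward_two_boxes_le:
  assumes ST: "finite S" "S \<noteq> {}" "finite T" "T \<noteq> {}"
    and g: "g \<in> borel_measurable (\<Pi>\<^sub>M k\<in>{1..2}. borel)"
    and le: "\<And>w. w 1 \<in> S \<Longrightarrow> w 2 \<in> T \<Longrightarrow> selected_reward 2 A \<pi> w \<le> g w \<and> 0 \<le> g w"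
  shows "expected_reward 2 (two_boxes S T) A \<pi> \<le>
    (\<Sum>p\<in>S \<times> T. g (reward_vector p)) / (card S * card T)"
proof -
  have "expected_reward 2 (two_boxes S T) A \<pi> \<le> (\<integral>w. g w \<partial>joint_law 2 (two_boxes S T))"
    unfolding expected_reward_def
  proof (rule integral_mono_AE')
    show "integrable (joint_law 2 (two_boxes S T)) g"
      using integral_two_boxes(1) [OF ST g] .
    show "AE w in joint_law 2 (two_boxes S T). selected_reward 2 A \<pi> w \<le> g w"
      using AE_two_boxes [OF ST] by eventually_elim (use le in blast)
    show "AE w in joint_law 2 (two_boxes S T). 0 \<le> g w"
      using AE_two_boxes [OF ST] by eventually_elim (use le in blast)
  qed
  then show ?thesis
    using integral_two_boxes(2) [OF ST g] by simp
qed

section \<open>Upper bounds in the example, one for each arrival order\<close>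

abbreviation example_boxes :: "nat \<Rightarrow> real measure" where
  "example_boxes \<equiv> two_boxes {0, 3/2} {1, 3}"

lemma measurable_reward [measurable]:
  "(\<lambda>w. w 1) \<in> borel_measurable (\<Pi>\<^sub>M k\<in>{1..2::nat}. (borel :: real measure))"
  "(\<lambda>w. w 2) \<in> borel_measurable (\<Pi>\<^sub>M k\<in>{1..2::nat}. (borel :: real measure))"
  by measurable

lemma expected_reward_example_id_le:
  "expected_reward 2 example_boxes A id \<le> (if A [3/2] [] then 7/4 else 2)"
proof (cases "A [3/2] []")
  case True
  \<comment> \<open>Once 3/2 is taken, the best that remains is to pass over 0 and take box 2; the
    average is (3/2 + 2)/2 = 7/4.\<close>
  let ?g = "\<lambda>w :: nat \<Rightarrow> real. if w 1 = 3/2 then 3/2 else w 2"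
  have "?g \<in> borel_measurable (\<Pi>\<^sub>M k\<in>{1..2}. borel)" by measurable
  then have "expected_reward 2 example_boxes A id \<le>
      (\<Sum>p\<in>{0, 3/2} \<times> {1, 3}. ?g (reward_vector p)) / (card {0, 3/2 :: real} * card {1, 3 :: real})"
    using True
    by (intro expected_reward_two_boxes_le)
      (auto simp: selected_reward_two simp del: eq_divide_eq_numeral1)
  then show ?thesis
    using True by (simp add: reward_vector_def flip: sum.cartesian_product)
next
  case False
  \<comment> \<open>With 3/2 rejected, box 1 can contribute only 0, so box 2 dominates the
    outcome.\<close>
  let ?g = "\<lambda>w :: nat \<Rightarrow> real. w 2"
  have "?g \<in> borel_measurable (\<Pi>\<^sub>M k\<in>{1..2}. borel)" by measurable
  then have "expected_reward 2 example_boxes A id \<le>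
      (\<Sum>p\<in>{0, 3/2} \<times> {1, 3}. ?g (reward_vector p)) / (card {0, 3/2 :: real} * card {1, 3 :: real})"
    using False
    by (intro expected_reward_two_boxes_le)
      (auto simp: selected_reward_two simp del: eq_divide_eq_numeral1)
  then show ?thesis
    using False by (simp add: reward_vector_def flip: sum.cartesian_product)
qed

lemma expected_reward_example_transpose_less:
  assumes "\<not> A [1] []"
  shows "expected_reward 2 example_boxes A (Transposition.transpose 1 2) < 2"
proof -
  \<comment> \<open>After rejecting 1, at most the reward of box 1 is left, with mean 3/4; a first
    reward 3 is best accepted. The average is (3/4 + 3)/2 = 15/8.\<close>
  let ?g = "\<lambda>w :: nat \<Rightarrow> real. if w 2 = 1 then w 1 else 3"
  have "?g \<in> borel_measurable (\<Pi>\<^sub>M k\<in>{1..2}. borel)" by measurable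
  then have "expected_reward 2 example_boxes A (Transposition.transpose 1 2) \<le>
      (\<Sum>p\<in>{0, 3/2} \<times> {1, 3}. ?g (reward_vector p)) / (card {0, 3/2 :: real} * card {1, 3 :: real})"
    using assms
    by (intro expected_reward_two_boxes_le)
      (auto simp: selected_reward_two simp del: eq_divide_eq_numeral1)
  also have "\<dots> < 2"
    by (simp add: reward_vector_def flip: sum.cartesian_product)
  finally show ?thesis .
qed

section \<open>A rule with guarantee 2\<close>

definition example_rule :: decision_rule where
  "example_rule vs ids \<longleftrightarrow> length vs = 2 \<or> hd vs \<notin> {0, 3/2}"

lemma identity_truthful_example_rule: "identity_truthful 2 example_rule"
  unfolding identity_truthful_def
proof (intro ballI allI)
  fix i :: nat and ids :: "nat list"
  assume "i \<in> {1..2}"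
  then consider "i = 1" | "i = 2" by fastforce
  then show "(\<lambda>v. example_rule (map v [1..<Suc i]) ids)
      \<in> measurable (\<Pi>\<^sub>M j\<in>{1..i}. (borel :: real measure)) (count_space UNIV)"
  proof cases
    case 1
    have [measurable]: "(\<lambda>v. v 1) \<in> borel_measurable (\<Pi>\<^sub>M j\<in>{1..1::nat}. (borel :: real measure))"
      by measurable
    have "(\<lambda>v. v 1 \<noteq> 0 \<and> v 1 \<noteq> 3/2)
        \<in> measurable (\<Pi>\<^sub>M j\<in>{1..1::nat}. (borel :: real measure)) (count_space UNIV)"
      by measurable
    with 1 show ?thesis by (simp add: example_rule_def)
  next
    case 2
    then show ?thesis by (simp add: example_rule_def)
  qed
qed

text \<open>In both orders the rule almost surely selects box 2, whose mean is 2: it passes over the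
  support of box 1 at step 1 and takes anything at step 2.\<close>

lemma guarantee_example_rule: "guarantee 2 example_boxes example_rule = 2"
proof -
  \<comment> \<open>This agrees with the selected reward at every \<open>w\<close>, also off the
    supports, so the integrals agree without an almost-everywhere argument.\<close>
  let ?f = "\<lambda>w :: nat \<Rightarrow> real. if w 1 \<noteq> 0 \<and> w 1 \<noteq> 3/2 then w 1 else w 2"
  have f: "?f \<in> borel_measurable (\<Pi>\<^sub>M k\<in>{1..2}. borel)" by measurable
  have "expected_reward 2 example_boxes example_rule id =
      (\<integral>w. ?f w \<partial>joint_law 2 example_boxes)"
    unfolding expected_reward_def
    by (intro Bochner_Integration.integral_cong) (auto simp: selected_reward_two example_rule_def)
  also have "\<dots> = 2"
    by (subst integral_two_boxes(2) [OF _ _ _ _ f])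
      (simp_all add: reward_vector_def flip: sum.cartesian_product)
  finally have id: "expected_reward 2 example_boxes example_rule id = 2" .
  let ?g = "\<lambda>w :: nat \<Rightarrow> real. if w 2 \<noteq> 0 \<and> w 2 \<noteq> 3/2 then w 2 else w 1"
  have g: "?g \<in> borel_measurable (\<Pi>\<^sub>M k\<in>{1..2}. borel)" by measurable
  have "expected_reward 2 example_boxes example_rule (Transposition.transpose 1 2) =
      (\<integral>w. ?g w \<partial>joint_law 2 example_boxes)"
    unfolding expected_reward_def
    by (intro Bochner_Integration.integral_cong) (auto simp: selected_reward_two example_rule_def)
  also have "\<dots> = 2"
    by (subst integral_two_boxes(2) [OF _ _ _ _ g])
      (simp_all add: reward_vector_def flip: sum.cartesian_product)
  finally have swap: "expected_reward 2 example_boxes example_rule (Transposition.transpose 1 2) = 2" .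
  have "{1..2} = {1, 2::nat}" by auto
  then have "{\<pi>. \<pi> permutes {1..2::nat}} = {id, Transposition.transpose 1 2}"
    by (auto simp: permutes_doubleton_iff)
  then show ?thesis
    using id swap by (simp add: guarantee_def)
qed

section \<open>Monotonicity of pricing at the first step\<close>

lemma pricing_first_step_mono:
  assumes "adheres_to_pricing n A" "1 \<le> n" "A [x] []" "0 \<le> x" "x \<le> y"
  shows "A [y] []"
proof -
  from assms(1,2) obtain \<tau> :: "real list \<Rightarrow> nat list \<Rightarrow> ereal" where
    \<tau>: "\<And>w. \<forall>k\<in>{1..n}. 0 \<le> w k \<Longrightarrow> accepts A id w 1 \<longleftrightarrow>
      ereal (arriving_reward id w 1) \<ge> \<tau> (rewards_upto id w 0) (identities_upto id 0)"
    unfolding adheres_to_pricing_def by (fastforce dest: spec [of _ id] simp: permutes_id)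
  \<comment> \<open>Before step 1 nothing has been observed, so a single threshold serves all first
    rewards. The constant vector \<open>z\<close> shows \<open>z\<close> first and is nonnegative in
    every box.\<close>
  have "A [z] [] \<longleftrightarrow> \<tau> [] [] \<le> ereal z" if "0 \<le> z" for z
    using \<tau> [of "\<lambda>_. z"] that
    by (simp add: accepts_def rewards_upto_def identities_upto_def arriving_reward_def)
  then show ?thesis
    using assms(3-5) by (meson ereal_less_eq(3) order_trans)
qed

theorem theorem3:
  "\<exists>(n :: nat) (F :: nat \<Rightarrow> real measure).
     box_instance n F \<and>
     (\<exists>A. optimum_identity_truthful n F A) \<and>
     (\<forall>A. optimum_identity_truthful n F A \<longrightarrow> \<not> adheres_to_pricing n A)"
proof (intro exI conjI allI impI notI)
  show "box_instance 2 example_boxes"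
    by (rule box_instance_two_boxes) auto
  have perms: "id permutes {1..2::nat}" "Transposition.transpose 1 2 permutes {1..2::nat}"
    by (auto intro: permutes_id permutes_swap_id)
  \<comment> \<open>The order with box 1 first already caps every guarantee.\<close>
  have "guarantee 2 example_boxes B \<le> 2" for B
    using guarantee_le_expected_reward [OF perms(1), of example_boxes B]
      expected_reward_example_id_le [of B] by (auto split: if_splits)
  then show "optimum_identity_truthful 2 example_boxes example_rule"
    by (simp add: optimum_identity_truthful_def identity_truthful_example_rule
        guarantee_example_rule)
  fix A
  assume "optimum_identity_truthful 2 example_boxes A" and pricing: "adheres_to_pricing 2 A"
  then have opt: "2 \<le> guarantee 2 example_boxes A"
    using identity_truthful_example_rule guarantee_example_rule
    by (auto simp: optimum_identity_truthful_def)
  have "A [1] []"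
    using opt guarantee_le_expected_reward [OF perms(2), of example_boxes A]
      expected_reward_example_transpose_less [of A] by fastforce
  \<comment> \<open>The forced acceptance of 1, a reward of box 2, carries over to 3/2, a reward of
    box 1, which drops the value in the order \<open>id\<close> to at most 7/4.\<close>
  then have "A [3/2] []"
    using pricing_first_step_mono [OF pricing] by simp
  then show False
    using opt guarantee_le_expected_reward [OF perms(1), of example_boxes A]
      expected_reward_example_id_le [of A] by simp
qed

end
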